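(* Let $w_{\min}\le w_{\max}$ and $c_{\min}\le c_{\max}$ be real numbers and let $$\Omega_1=\{\mathbf U=(\rho,y,z)^\top\in\mathbb{R}^3:\ \rho>0,\ w(\mathbf U)\in[w_{\min},w_{\max}],\ c(\mathbf U)\in[c_{\min},c_{\max}]\}.$$ Let $\mathbf U=(\rho,y,z)^\top\in\Omega_1$ with $z>0$. If $\alpha>v(\mathbf U)>0$, then both $$\mathbf U+\alpha^{-1}\mathbf F(\mathbf U)\in\Omega_1\quad\text{and}\quad \mathbf U-\alpha^{-1}\mathbf F(\mathbf U)\in\Omega_1 .$$
   Context: Fix parameters $\gamma\ge 0$, $\kappa\ge\gamma+1$, $v_{\rm ref}>0$. For $\rho>0$, $z>0$ the pressure is $p(\rho,z)=\frac{v_{\rm ref}}{\gamma}z^{\kappa}\rho^{\gamma-\kappa}$ if $\gamma>0$, and $p(\rho,z)=v_{\rm ref}\log\rho$ if $\gamma=0$. For $\mathbf U=(\rho,y,z)^\top$ with $\rho>0$: $w(\mathbf U)=y/\rho$, $c(\mathbf U)=z/\rho$; when also $z>0$, $v(\mathbf U)=w(\mathbf U)-p(\rho,z)$ and $\mathbf F(\mathbf U)=v(\mathbf U)\,\mathbf U$. *)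

theory Defs
  imports "HOL-Analysis.Analysis"
begin

text \<open>A state is \<open>U = (\<rho>, y, z)\<close>, with \<open>\<rho> = U $ 1\<close>, \<open>y = U $ 2\<close>, \<open>z = U $ 3\<close>.
  The functions below are total in HOL, but \<open>w_of\<close> and \<open>c_of\<close> are meaningful only for
  \<open>\<rho> > 0\<close>, and \<open>pressure\<close>, \<open>velocity\<close> and \<open>flux\<close> only for \<open>\<rho> > 0\<close> and \<open>z > 0\<close>.\<close>

definition pressure :: "real \<Rightarrow> real \<Rightarrow> real \<Rightarrow> real \<Rightarrow> real \<Rightarrow> real" where
  "pressure \<gamma> \<kappa> v\<^sub>r\<^sub>e\<^sub>f \<rho> z =
     (if \<gamma> > 0 then v\<^sub>r\<^sub>e\<^sub>f / \<gamma> * z powr \<kappa> * \<rho> powr (\<gamma> - \<kappa>) else v\<^sub>r\<^sub>e\<^sub>f * ln \<rho>)"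

definition w_of :: "real ^ 3 \<Rightarrow> real" where
  "w_of U = U $ 2 / U $ 1"

definition c_of :: "real ^ 3 \<Rightarrow> real" where
  "c_of U = U $ 3 / U $ 1"

definition velocity :: "real \<Rightarrow> real \<Rightarrow> real \<Rightarrow> real ^ 3 \<Rightarrow> real" where
  "velocity \<gamma> \<kappa> v\<^sub>r\<^sub>e\<^sub>f U = w_of U - pressure \<gamma> \<kappa> v\<^sub>r\<^sub>e\<^sub>f (U $ 1) (U $ 3)"

definition flux :: "real \<Rightarrow> real \<Rightarrow> real \<Rightarrow> real ^ 3 \<Rightarrow> real ^ 3" where
  "flux \<gamma> \<kappa> v\<^sub>r\<^sub>e\<^sub>f U = velocity \<gamma> \<kappa> v\<^sub>r\<^sub>e\<^sub>f U *\<^sub>R U"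

definition Omega1 :: "real \<Rightarrow> real \<Rightarrow> real \<Rightarrow> real \<Rightarrow> (real ^ 3) set" where
  "Omega1 w\<^sub>m\<^sub>i\<^sub>n w\<^sub>m\<^sub>a\<^sub>x c\<^sub>m\<^sub>i\<^sub>n c\<^sub>m\<^sub>a\<^sub>x =
     {U. U $ 1 > 0 \<and> w_of U \<in> {w\<^sub>m\<^sub>i\<^sub>n..w\<^sub>m\<^sub>a\<^sub>x} \<and> c_of U \<in> {c\<^sub>m\<^sub>i\<^sub>n..c\<^sub>m\<^sub>a\<^sub>x}}"

end

theory Submission
  imports Defs
begin

text \<open>The flux is a scalar multiple of the state, so adding or subtracting it over \<alpha>
  only rescales \<open>U\<close>, by the factors 1 + r and 1 - r with r = v/\<alpha>. Both factors
  are positive because 0 < v < \<alpha>. And \<open>Omega1\<close> is a cone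
  (\<open>scaleR_mem_Omega1\<close>): \<open>w_of\<close> and \<open>c_of\<close> are quotients of
  coordinates, hence unchanged by a positive factor, which also keeps the density positive.\<close>

lemma scaleR_mem_Omega1:
  assumes "t > 0" and "U \<in> Omega1 a b c d"
  shows "t *\<^sub>R U \<in> Omega1 a b c d"
  using assms by (simp add: Omega1_def w_of_def c_of_def)

theorem lemma2p3:
  fixes \<gamma> \<kappa> v\<^sub>r\<^sub>e\<^sub>f w\<^sub>m\<^sub>i\<^sub>n w\<^sub>m\<^sub>a\<^sub>x c\<^sub>m\<^sub>i\<^sub>n c\<^sub>m\<^sub>a\<^sub>x \<alpha> :: real
    and U :: "real ^ 3"
  assumes "\<gamma> \<ge> 0" and "\<kappa> \<ge> \<gamma> + 1" and "v\<^sub>r\<^sub>e\<^sub>f > 0"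
    and "w\<^sub>m\<^sub>i\<^sub>n \<le> w\<^sub>m\<^sub>a\<^sub>x" and "c\<^sub>m\<^sub>i\<^sub>n \<le> c\<^sub>m\<^sub>a\<^sub>x"
    and "U \<in> Omega1 w\<^sub>m\<^sub>i\<^sub>n w\<^sub>m\<^sub>a\<^sub>x c\<^sub>m\<^sub>i\<^sub>n c\<^sub>m\<^sub>a\<^sub>x" and "U $ 3 > 0"
    and "\<alpha> > velocity \<gamma> \<kappa> v\<^sub>r\<^sub>e\<^sub>f U" and "velocity \<gamma> \<kappa> v\<^sub>r\<^sub>e\<^sub>f U > 0"
  shows "U + inverse \<alpha> *\<^sub>R flux \<gamma> \<kappa> v\<^sub>r\<^sub>e\<^sub>f U \<in> Omega1 w\<^sub>m\<^sub>i\<^sub>n w\<^sub>m\<^sub>a\<^sub>x c\<^sub>m\<^sub>i\<^sub>n c\<^sub>m\<^sub>a\<^sub>x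
       \<and> U - inverse \<alpha> *\<^sub>R flux \<gamma> \<kappa> v\<^sub>r\<^sub>e\<^sub>f U \<in> Omega1 w\<^sub>m\<^sub>i\<^sub>n w\<^sub>m\<^sub>a\<^sub>x c\<^sub>m\<^sub>i\<^sub>n c\<^sub>m\<^sub>a\<^sub>x"
proof -
  define r where "r = inverse \<alpha> * velocity \<gamma> \<kappa> v\<^sub>r\<^sub>e\<^sub>f U"
  \<comment> \<open>The two velocity bounds force \<alpha> > 0, so dividing by \<alpha> preserves
    them. The upper bound on \<open>r\<close> is what makes the factor 1 - r positive in the minus
    case.\<close>
  have "0 < r" "r < 1"
    using assms(8,9) by (simp_all add: r_def field_simps)
  moreover have
    "U + inverse \<alpha> *\<^sub>R flux \<gamma> \<kappa> v\<^sub>r\<^sub>e\<^sub>f U = (1 + r) *\<^sub>R U"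
    "U - inverse \<alpha> *\<^sub>R flux \<gamma> \<kappa> v\<^sub>r\<^sub>e\<^sub>f U = (1 - r) *\<^sub>R U"
    by (simp_all add: flux_def r_def algebra_simps)
  ultimately show ?thesis
    using assms(6) by (simp add: scaleR_mem_Omega1)
qed

end
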